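(* Let $K$ be a field, $\lambda\in K$. Let $(A,\mu,1,\alpha_A,\beta_A,\psi_A,\omega_A,r)$ be an anti-quasitriangular unitary $\lambda$-infBH-bialgebra and let $(M,\triangleleft,\alpha_M,\beta_M)$ be a right $(A,\mu,\alpha_A,\beta_A)$-module, with $\alpha_M$ invertible. Let $\psi_M,\omega_M:M\to M$ be linear maps such that $\alpha_M\omega_M=\omega_M\alpha_M$ and $\omega_M(m\triangleleft a)=\omega_M(m)\triangleleft\omega_A(a)$ for $a\in A$, $m\in M$. Then $(M,\triangleleft,\widetilde\varphi,\alpha_M,\beta_M,\psi_M,\omega_M)$ is a right $\lambda$-infBH-Hopf module over $A$ (with comultiplication $\widetilde\Delta_r$), where the coaction $\widetilde\varphi:M\to M\otimes A$ is given by $$\widetilde\varphi(m)=\omega_M\alpha_M^{-1}(m)\triangleleft r^1\otimes\beta_A(r^2),\qquad m\in M.$$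
   Context: Everything is over the field $K$. BiHom-associative algebra $(A,\mu,\alpha,\beta)$: $\mu$ (written $ab$) and $\alpha,\beta$ linear, $\alpha\beta=\beta\alpha$, $\alpha,\beta$ multiplicative, $\alpha(a)(bc)=(ab)\beta(c)$. Unitary: there is $1\in A$ with $\alpha(1)=\beta(1)=1$, $a1=\alpha(a)$, $1a=\beta(a)$. Anti-quasitriangular unitary $\lambda$-infBH-bialgebra ($\lambda$-infinitesimal BiHom-bialgebra) $(A,\mu,1,\alpha,\beta,\psi,\omega,r)$: $(A,\mu,1,\alpha,\beta)$ is a unitary BiHom-associative algebra with $\alpha,\beta$ bijective; $\psi,\omega:A\to A$ are linear, multiplicative, each commutes with $\alpha$ and with $\beta$, and $\psi(1)=\omega(1)=1$; $r=r^1\otimes r^2\in A\otimes A$ (summation understood) is invariant under $f\otimes f$ for $f\in\{\alpha,\beta,\psi,\omega\}$; and, with $\bar r$ a second copy of $r$, $$\omega(r^1)\bar r^1\otimes\beta(\bar r^2)\otimes\alpha\psi(r^2)-\alpha(r^1)\otimes r^2\bar r^1\otimes\beta(\bar r^2)+\beta\omega(r^1)\otimes\alpha(\bar r^1)\otimes\bar r^2\psi(r^2)=-\lambda\,\omega(r^1)\otimes1\otimes\psi(r^2).$$ Its comultiplication is $\widetilde\Delta_r(a)=\omega\alpha^{-1}(a)r^1\otimes\beta(r^2)-\alpha(r^1)\otimes r^2\psi\beta^{-1}(a)-\lambda\,1\otimes\psi(a)$. Right module $(M,\triangleleft,\alpha_M,\beta_M)$: $\alpha_M\beta_M=\beta_M\alpha_M$;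 $f_M(m\triangleleft a)=f_M(m)\triangleleft f_A(a)$ for $f\in\{\alpha,\beta\}$; $\alpha_M(m)\triangleleft(aa')=(m\triangleleft a)\triangleleft\beta_A(a')$. Right comodule $(M,\varphi,\psi_M,\omega_M)$ over $(A,\Delta,\psi_A,\omega_A)$: $\psi_M\omega_M=\omega_M\psi_M$; $(g_M\otimes g_A)\varphi=\varphi g_M$ for $g\in\{\psi,\omega\}$; $(\omega_M\otimes\Delta)\varphi=(\varphi\otimes\psi_A)\varphi$. Right $\lambda$-infBH-Hopf module $(M,\triangleleft,\varphi,\alpha_M,\beta_M,\psi_M,\omega_M)$: a right module and a right comodule, any two of $\alpha_M,\beta_M,\psi_M,\omega_M$ commute, and, with $\varphi(m)=m_{(0)}\otimes m_{(1)}$, $\Delta(a)=a_1\otimes a_2$, $\varphi(m\triangleleft a)=\omega_M(m)\triangleleft a_1\otimes\beta_A(a_2)+\alpha_M(m_{(0)})\otimes m_{(1)}\psi_A(a)+\lambda\,\alpha_M\omega_M(m)\otimes\beta_A\psi_A(a)$.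
   Formalization: The formal theorem also assumes that ψ_M commutes with α_M, β_M, ω_M, that ω_M commutes with β_M, that ψ_M(m◁a)=ψ_M(m)◁ψ_A(a), and, if λ≠0, that m◁1=α_M(m); without such conditions the claim fails. *)

theory Defs
  imports Complex_Main "HOL-Library.Poly_Mapping"
begin

section \<open>Tensor products of vector spaces\<close>

text \<open>
  Vector spaces over a field are given as in \<^theory>\<open>HOL.Vector_Spaces\<close>, by a type together with a
  scalar multiplication.  The tensor product is the free vector space on the set of pairs (triples)
  modulo the subspace spanned by the bilinearity (trilinearity) relations; its elements are the
  cosets of that subspace.  A type cannot depend on the scalar multiplications, so the quotient is
  not a type of its own: its operations carry the subspace \<open>W\<close> of relations as a parameter, and
  its underlying set is \<open>quotient_space W\<close>.
\<close>

definition free_scale :: "'k::field \<Rightarrow> ('x \<Rightarrow>\<^sub>0 'k) \<Rightarrow> ('x \<Rightarrow>\<^sub>0 'k)" where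
  "free_scale c p = Poly_Mapping.map ((*) c) p"

definition free_gen :: "'x \<Rightarrow> ('x \<Rightarrow>\<^sub>0 'k::field)" where
  "free_gen x = Poly_Mapping.single x 1"

definition free_extend :: "('x \<Rightarrow> ('y \<Rightarrow>\<^sub>0 'k::field)) \<Rightarrow> ('x \<Rightarrow>\<^sub>0 'k) \<Rightarrow> ('y \<Rightarrow>\<^sub>0 'k)" where
  "free_extend h p = (\<Sum>x\<in>Poly_Mapping.keys p. free_scale (Poly_Mapping.lookup p x) (h x))"

definition tensor_rel ::
  "('k::field \<Rightarrow> 'v::ab_group_add \<Rightarrow> 'v) \<Rightarrow> ('k \<Rightarrow> 'w::ab_group_add \<Rightarrow> 'w) \<Rightarrow> ('v \<times> 'w \<Rightarrow>\<^sub>0 'k) set" where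
  "tensor_rel sV sW = module.span free_scale
     ({free_gen (v + v', w) - free_gen (v, w) - free_gen (v', w) | v v' w. True} \<union>
      {free_gen (v, w + w') - free_gen (v, w) - free_gen (v, w') | v w w'. True} \<union>
      {free_gen (sV c v, w) - free_scale c (free_gen (v, w)) | c v w. True} \<union>
      {free_gen (v, sW c w) - free_scale c (free_gen (v, w)) | c v w. True})"

definition tensor_rel3 ::
  "('k::field \<Rightarrow> 'u::ab_group_add \<Rightarrow> 'u) \<Rightarrow> ('k \<Rightarrow> 'v::ab_group_add \<Rightarrow> 'v) \<Rightarrow>
   ('k \<Rightarrow> 'w::ab_group_add \<Rightarrow> 'w) \<Rightarrow> ('u \<times> 'v \<times> 'w \<Rightarrow>\<^sub>0 'k) set" where
  "tensor_rel3 sU sV sW = module.span free_scale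
     ({free_gen (u + u', v, w) - free_gen (u, v, w) - free_gen (u', v, w) | u u' v w. True} \<union>
      {free_gen (u, v + v', w) - free_gen (u, v, w) - free_gen (u, v', w) | u v v' w. True} \<union>
      {free_gen (u, v, w + w') - free_gen (u, v, w) - free_gen (u, v, w') | u v w w'. True} \<union>
      {free_gen (sU c u, v, w) - free_scale c (free_gen (u, v, w)) | c u v w. True} \<union>
      {free_gen (u, sV c v, w) - free_scale c (free_gen (u, v, w)) | c u v w. True} \<union>
      {free_gen (u, v, sW c w) - free_scale c (free_gen (u, v, w)) | c u v w. True})"

definition coset :: "('y \<Rightarrow>\<^sub>0 'k::field) set \<Rightarrow> ('y \<Rightarrow>\<^sub>0 'k) \<Rightarrow> ('y \<Rightarrow>\<^sub>0 'k) set" where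
  "coset W p = {q. q - p \<in> W}"

definition quotient_space :: "('y \<Rightarrow>\<^sub>0 'k::field) set \<Rightarrow> ('y \<Rightarrow>\<^sub>0 'k) set set" where
  "quotient_space W = range (coset W)"

definition rep :: "('y \<Rightarrow>\<^sub>0 'k::field) set \<Rightarrow> ('y \<Rightarrow>\<^sub>0 'k)" where
  "rep X = (SOME p. p \<in> X)"

definition qadd :: "('y \<Rightarrow>\<^sub>0 'k::field) set \<Rightarrow> ('y \<Rightarrow>\<^sub>0 'k) set \<Rightarrow> ('y \<Rightarrow>\<^sub>0 'k) set \<Rightarrow> ('y \<Rightarrow>\<^sub>0 'k) set" where
  "qadd W X Y = coset W (rep X + rep Y)"

definition qdiff :: "('y \<Rightarrow>\<^sub>0 'k::field) set \<Rightarrow> ('y \<Rightarrow>\<^sub>0 'k) set \<Rightarrow> ('y \<Rightarrow>\<^sub>0 'k) set \<Rightarrow> ('y \<Rightarrow>\<^sub>0 'k) set" where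
  "qdiff W X Y = coset W (rep X - rep Y)"

definition qscale :: "('y \<Rightarrow>\<^sub>0 'k::field) set \<Rightarrow> 'k \<Rightarrow> ('y \<Rightarrow>\<^sub>0 'k) set \<Rightarrow> ('y \<Rightarrow>\<^sub>0 'k) set" where
  "qscale W c X = coset W (free_scale c (rep X))"

text \<open>The class of the pure tensor \<open>v \<otimes> w\<close> (\<open>x\<close> a pair) or \<open>u \<otimes> v \<otimes> w\<close> (\<open>x\<close> a triple).\<close>

definition tens :: "('x \<Rightarrow>\<^sub>0 'k::field) set \<Rightarrow> 'x \<Rightarrow> ('x \<Rightarrow>\<^sub>0 'k) set" where
  "tens W x = coset W (free_gen x)"

text \<open>
  Sweedler notation: \<open>sweedler W (\<lambda>v w. b v w) T\<close> is \<open>b T\<^sub>1 T\<^sub>2\<close> (summation understood) for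
  \<open>T = T\<^sub>1 \<otimes> T\<^sub>2\<close>, that is, the value at \<open>T\<close> of the linear map on the tensor product induced by the
  map \<open>b\<close> into the quotient by \<open>W\<close>.  It is only used for bilinear \<open>b\<close>, where the choice of
  representatives does not matter: see \<open>sweedler_coset\<close> and \<open>sweedler_tens\<close> below.
\<close>

definition sweedler ::
  "('y \<Rightarrow>\<^sub>0 'k::field) set \<Rightarrow> ('v \<Rightarrow> 'w \<Rightarrow> ('y \<Rightarrow>\<^sub>0 'k) set) \<Rightarrow> ('v \<times> 'w \<Rightarrow>\<^sub>0 'k) set \<Rightarrow> ('y \<Rightarrow>\<^sub>0 'k) set" where
  "sweedler W b T = coset W (free_extend (\<lambda>(v, w). rep (b v w)) (rep T))"

definition linear_into_quotient ::
  "('k::field \<Rightarrow> 'v::ab_group_add \<Rightarrow> 'v) \<Rightarrow> ('y \<Rightarrow>\<^sub>0 'k) set \<Rightarrow> ('v \<Rightarrow> ('y \<Rightarrow>\<^sub>0 'k) set) \<Rightarrow> bool" where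
  "linear_into_quotient sV W f \<longleftrightarrow>
     (\<forall>v. f v \<in> quotient_space W) \<and>
     (\<forall>v v'. f (v + v') = qadd W (f v) (f v')) \<and>
     (\<forall>c v. f (sV c v) = qscale W c (f v))"

definition bilinear_over ::
  "('k::field \<Rightarrow> 'v::ab_group_add \<Rightarrow> 'v) \<Rightarrow> ('k \<Rightarrow> 'w::ab_group_add \<Rightarrow> 'w) \<Rightarrow>
   ('k \<Rightarrow> 'u::ab_group_add \<Rightarrow> 'u) \<Rightarrow> ('v \<Rightarrow> 'w \<Rightarrow> 'u) \<Rightarrow> bool" where
  "bilinear_over sV sW sU f \<longleftrightarrow>
     (\<forall>w. Vector_Spaces.linear sV sU (\<lambda>v. f v w)) \<and> (\<forall>v. Vector_Spaces.linear sW sU (f v))"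


subsection \<open>Independence of representatives\<close>

lemma lookup_free_scale [simp]:
  "Poly_Mapping.lookup (free_scale c p) x = c * Poly_Mapping.lookup p x"
  by (simp add: free_scale_def map.rep_eq when_def)

lemma vector_space_free: "vector_space (free_scale :: 'k::field \<Rightarrow> ('x \<Rightarrow>\<^sub>0 'k) \<Rightarrow> _)"
  by unfold_locales (auto intro!: poly_mapping_eqI simp: lookup_add algebra_simps)

interpretation free: vector_space "free_scale :: 'k::field \<Rightarrow> ('x \<Rightarrow>\<^sub>0 'k) \<Rightarrow> _"
  by (rule vector_space_free)

lemma subspace_tensor_rel: "free.subspace (tensor_rel sV sW)"
  unfolding tensor_rel_def by (rule free.subspace_span)

lemma subspace_tensor_rel3: "free.subspace (tensor_rel3 sU sV sW)"
  unfolding tensor_rel3_def by (rule free.subspace_span)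

lemma coset_eq_iff:
  assumes W: "free.subspace W"
  shows "coset W p = coset W q \<longleftrightarrow> p - q \<in> W"
proof
  assume "coset W p = coset W q"
  moreover have "p \<in> coset W p"
    using W by (simp add: coset_def free.subspace_0)
  ultimately show "p - q \<in> W"
    by (simp add: coset_def)
next
  assume *: "p - q \<in> W"
  have "x - p \<in> W \<longleftrightarrow> x - q \<in> W" for x
    using free.subspace_add[OF W _ *, of "x - p"] free.subspace_diff[OF W _ *, of "x - q"] by auto
  then show "coset W p = coset W q"
    by (simp add: coset_def)
qed

lemma rep_coset: "free.subspace W \<Longrightarrow> rep (coset W p) - p \<in> W"
  unfolding rep_def
  by (rule someI2[of _ p]) (auto simp: coset_def free.subspace_0)

lemma free_extend_superset:
  assumes "finite S" "Poly_Mapping.keys p \<subseteq> S"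
  shows "free_extend h p = (\<Sum>x\<in>S. free_scale (Poly_Mapping.lookup p x) (h x))"
  unfolding free_extend_def
  by (rule sum.mono_neutral_left) (use assms in \<open>auto simp: in_keys_iff\<close>)

lemma linear_free_extend: "Vector_Spaces.linear free_scale free_scale (free_extend h)"
proof (unfold_locales, goal_cases)
  case (1 p q)
  let ?S = "Poly_Mapping.keys p \<union> Poly_Mapping.keys q"
  have "free_extend h (p + q) = (\<Sum>x\<in>?S. free_scale (Poly_Mapping.lookup (p + q) x) (h x))"
    by (rule free_extend_superset) (auto simp: Poly_Mapping.keys_add)
  also have "\<dots> = free_extend h p + free_extend h q"
    by (simp add: free_extend_superset[of ?S] lookup_add free.scale_left_distrib sum.distrib)
  finally show ?case .
next
  case (2 c p)
  have "free_extend h (free_scale c p) =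
      (\<Sum>x\<in>Poly_Mapping.keys p. free_scale (Poly_Mapping.lookup (free_scale c p) x) (h x))"
    by (rule free_extend_superset) (auto simp: in_keys_iff)
  then show ?case
    by (simp add: free_extend_def free.scale_sum_right)
qed

lemma free_extend_gen [simp]: "free_extend h (free_gen x) = h x"
  by (simp add: free_extend_def free_gen_def)

lemma free_extend_tensor_rel:
  assumes W: "free.subspace W"
    and l: "\<And>w. linear_into_quotient sV W (\<lambda>v. b v w)" and r: "\<And>v. linear_into_quotient sW W (b v)"
    and p: "p \<in> tensor_rel sV sW"
  shows "free_extend (\<lambda>(v, w). rep (b v w)) p \<in> W"
proof -
  let ?E = "free_extend (\<lambda>(v, w). rep (b v w))"
  interpret E: Vector_Spaces.linear free_scale free_scale ?E
    by (rule linear_free_extend)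
  have add: "rep (f (x + y)) - rep (f x) - rep (f y) \<in> W" if "linear_into_quotient s W f"
    for s :: "'a \<Rightarrow> 'z::ab_group_add \<Rightarrow> 'z" and f x y
    using that rep_coset[OF W, of "rep (f x) + rep (f y)"]
    by (simp add: linear_into_quotient_def qadd_def diff_diff_eq)
  have scale: "rep (f (s c x)) - free_scale c (rep (f x)) \<in> W" if "linear_into_quotient s W f"
    for s :: "'a \<Rightarrow> 'z::ab_group_add \<Rightarrow> 'z" and f c x
    using that rep_coset[OF W, of "free_scale c (rep (f x))"]
    by (simp add: linear_into_quotient_def qscale_def)
  have "free.subspace (?E -` W)"
    using W by (auto simp: free.subspace_def E.add E.scale)
  then have "tensor_rel sV sW \<subseteq> ?E -` W"
    unfolding tensor_rel_def
    by (intro free.span_minimal)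
       (auto simp: E.add E.diff E.scale intro: add[OF l] add[OF r] scale[OF l] scale[OF r])
  with p show ?thesis by auto
qed

lemma sweedler_coset:
  assumes W: "free.subspace W"
    and l: "\<And>w. linear_into_quotient sV W (\<lambda>v. b v w)" and r: "\<And>v. linear_into_quotient sW W (b v)"
  shows "sweedler W b (coset (tensor_rel sV sW) p) = coset W (free_extend (\<lambda>(v, w). rep (b v w)) p)"
proof -
  interpret E: Vector_Spaces.linear free_scale free_scale "free_extend (\<lambda>(v, w). rep (b v w))"
    by (rule linear_free_extend)
  show ?thesis
    using free_extend_tensor_rel[OF W l r rep_coset[OF subspace_tensor_rel], of p]
    by (simp add: sweedler_def coset_eq_iff[OF W] E.diff)
qed

lemma coset_rep: "free.subspace W \<Longrightarrow> X \<in> quotient_space W \<Longrightarrow> coset W (rep X) = X"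
  unfolding quotient_space_def by (metis coset_eq_iff imageE rep_coset)

lemma sweedler_tens:
  assumes W: "free.subspace W"
    and l: "\<And>w. linear_into_quotient sV W (\<lambda>v. b v w)" and r: "\<And>v. linear_into_quotient sW W (b v)"
  shows "sweedler W b (tens (tensor_rel sV sW) (v, w)) = b v w"
  using r[of v] coset_rep[OF W, of "b v w"] sweedler_coset[OF W l r, of "free_gen (v, w)"]
  by (auto simp: tens_def linear_into_quotient_def)


section \<open>BiHom-associative algebras\<close>

locale bihom_assoc_algebra =
  fixes sA :: "'k::field \<Rightarrow> 'a::ab_group_add \<Rightarrow> 'a"
    and mu :: "'a \<Rightarrow> 'a \<Rightarrow> 'a"
    and \<alpha> \<beta> :: "'a \<Rightarrow> 'a"
  assumes vector_space_A: "vector_space sA"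
    and bilinear_mu: "bilinear_over sA sA sA mu"
    and linear_alpha: "Vector_Spaces.linear sA sA \<alpha>"
    and linear_beta: "Vector_Spaces.linear sA sA \<beta>"
    and alpha_beta: "\<alpha> (\<beta> a) = \<beta> (\<alpha> a)"
    and alpha_mu: "\<alpha> (mu a b) = mu (\<alpha> a) (\<alpha> b)"
    and beta_mu: "\<beta> (mu a b) = mu (\<beta> a) (\<beta> b)"
    and bihom_assoc: "mu (\<alpha> a) (mu b c) = mu (mu a b) (\<beta> c)"

locale unitary_bihom_assoc_algebra = bihom_assoc_algebra sA mu \<alpha> \<beta>
  for sA :: "'k::field \<Rightarrow> 'a::ab_group_add \<Rightarrow> 'a" and mu \<alpha> \<beta> +
  fixes one :: 'a
  assumes alpha_one: "\<alpha> one = one"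
    and beta_one: "\<beta> one = one"
    and mu_one: "mu a one = \<alpha> a"
    and one_mu: "mu one a = \<beta> a"


section \<open>Anti-quasitriangular unitary infinitesimal BiHom-bialgebras\<close>

definition invariant_tensor ::
  "('k::field \<Rightarrow> 'a::ab_group_add \<Rightarrow> 'a) \<Rightarrow> ('a \<times> 'a \<Rightarrow>\<^sub>0 'k) set \<Rightarrow> ('a \<Rightarrow> 'a) \<Rightarrow> bool" where
  "invariant_tensor sA r f \<longleftrightarrow>
     sweedler (tensor_rel sA sA) (\<lambda>r1 r2. tens (tensor_rel sA sA) (f r1, f r2)) r = r"

text \<open>
  In \<open>anti_quasitriangular\<close>, \<open>r1 \<otimes> r2\<close> and \<open>s1 \<otimes> s2\<close> are the two copies of \<open>r\<close>.
\<close>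

locale anti_qt_bialgebra = unitary_bihom_assoc_algebra sA mu \<alpha> \<beta> one
  for sA :: "'k::field \<Rightarrow> 'a::ab_group_add \<Rightarrow> 'a" and mu \<alpha> \<beta> one +
  fixes lam :: 'k
    and \<psi> \<omega> :: "'a \<Rightarrow> 'a"
    and r :: "('a \<times> 'a \<Rightarrow>\<^sub>0 'k) set"
  assumes bij_alpha: "bij \<alpha>"
    and bij_beta: "bij \<beta>"
    and linear_psi: "Vector_Spaces.linear sA sA \<psi>"
    and linear_omega: "Vector_Spaces.linear sA sA \<omega>"
    and psi_mu: "\<psi> (mu a b) = mu (\<psi> a) (\<psi> b)"
    and omega_mu: "\<omega> (mu a b) = mu (\<omega> a) (\<omega> b)"
    and psi_alpha: "\<psi> (\<alpha> a) = \<alpha> (\<psi> a)"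
    and psi_beta: "\<psi> (\<beta> a) = \<beta> (\<psi> a)"
    and omega_alpha: "\<omega> (\<alpha> a) = \<alpha> (\<omega> a)"
    and omega_beta: "\<omega> (\<beta> a) = \<beta> (\<omega> a)"
    and psi_one: "\<psi> one = one"
    and omega_one: "\<omega> one = one"
    and r_in: "r \<in> quotient_space (tensor_rel sA sA)"
    and r_alpha: "invariant_tensor sA r \<alpha>"
    and r_beta: "invariant_tensor sA r \<beta>"
    and r_psi: "invariant_tensor sA r \<psi>"
    and r_omega: "invariant_tensor sA r \<omega>"
    and anti_quasitriangular:
      "let W = tensor_rel3 sA sA sA in
       qadd W
         (qdiff W
           (sweedler W (\<lambda>r1 r2. sweedler W (\<lambda>s1 s2. tens W (mu (\<omega> r1) s1, \<beta> s2, \<alpha> (\<psi> r2))) r) r)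
           (sweedler W (\<lambda>r1 r2. sweedler W (\<lambda>s1 s2. tens W (\<alpha> r1, mu r2 s1, \<beta> s2)) r) r))
         (sweedler W (\<lambda>r1 r2. sweedler W (\<lambda>s1 s2. tens W (\<beta> (\<omega> r1), \<alpha> s1, mu s2 (\<psi> r2))) r) r)
       = qscale W (- lam) (sweedler W (\<lambda>r1 r2. tens W (\<omega> r1, one, \<psi> r2)) r)"

definition comult_r ::
  "('k::field \<Rightarrow> 'a::ab_group_add \<Rightarrow> 'a) \<Rightarrow> ('a \<Rightarrow> 'a \<Rightarrow> 'a) \<Rightarrow> ('a \<Rightarrow> 'a) \<Rightarrow> ('a \<Rightarrow> 'a) \<Rightarrow> 'a \<Rightarrow> 'k \<Rightarrow>
   ('a \<Rightarrow> 'a) \<Rightarrow> ('a \<Rightarrow> 'a) \<Rightarrow> ('a \<times> 'a \<Rightarrow>\<^sub>0 'k) set \<Rightarrow> 'a \<Rightarrow> ('a \<times> 'a \<Rightarrow>\<^sub>0 'k) set" where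
  "comult_r sA mu \<alpha> \<beta> one lam \<psi> \<omega> r a =
     (let W = tensor_rel sA sA in
      qdiff W
        (qdiff W
          (sweedler W (\<lambda>r1 r2. tens W (mu (\<omega> (inv \<alpha> a)) r1, \<beta> r2)) r)
          (sweedler W (\<lambda>r1 r2. tens W (\<alpha> r1, mu r2 (\<psi> (inv \<beta> a)))) r))
        (qscale W lam (tens W (one, \<psi> a))))"


section \<open>Modules, comodules and Hopf modules\<close>

locale right_bihom_module = bihom_assoc_algebra sA mu \<alpha>\<^sub>A \<beta>\<^sub>A
  for sA :: "'k::field \<Rightarrow> 'a::ab_group_add \<Rightarrow> 'a" and mu \<alpha>\<^sub>A \<beta>\<^sub>A +
  fixes sM :: "'k \<Rightarrow> 'm::ab_group_add \<Rightarrow> 'm"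
    and act :: "'m \<Rightarrow> 'a \<Rightarrow> 'm"
    and \<alpha>\<^sub>M \<beta>\<^sub>M :: "'m \<Rightarrow> 'm"
  assumes vector_space_M: "vector_space sM"
    and bilinear_act: "bilinear_over sM sA sM act"
    and linear_alpha_M: "Vector_Spaces.linear sM sM \<alpha>\<^sub>M"
    and linear_beta_M: "Vector_Spaces.linear sM sM \<beta>\<^sub>M"
    and alpha_beta_M: "\<alpha>\<^sub>M (\<beta>\<^sub>M m) = \<beta>\<^sub>M (\<alpha>\<^sub>M m)"
    and alpha_act: "\<alpha>\<^sub>M (act m a) = act (\<alpha>\<^sub>M m) (\<alpha>\<^sub>A a)"
    and beta_act: "\<beta>\<^sub>M (act m a) = act (\<beta>\<^sub>M m) (\<beta>\<^sub>A a)"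
    and bihom_act: "act (\<alpha>\<^sub>M m) (mu a a') = act (act m a) (\<beta>\<^sub>A a')"

locale right_bihom_comodule =
  fixes sA :: "'k::field \<Rightarrow> 'a::ab_group_add \<Rightarrow> 'a"
    and \<Delta> :: "'a \<Rightarrow> ('a \<times> 'a \<Rightarrow>\<^sub>0 'k) set"
    and \<psi>\<^sub>A \<omega>\<^sub>A :: "'a \<Rightarrow> 'a"
    and sM :: "'k \<Rightarrow> 'm::ab_group_add \<Rightarrow> 'm"
    and \<phi> :: "'m \<Rightarrow> ('m \<times> 'a \<Rightarrow>\<^sub>0 'k) set"
    and \<psi>\<^sub>M \<omega>\<^sub>M :: "'m \<Rightarrow> 'm"
  assumes comodule_linear_psi_A: "Vector_Spaces.linear sA sA \<psi>\<^sub>A"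
    and comodule_linear_omega_A: "Vector_Spaces.linear sA sA \<omega>\<^sub>A"
    and linear_Delta: "linear_into_quotient sA (tensor_rel sA sA) \<Delta>"
    and linear_phi: "linear_into_quotient sM (tensor_rel sM sA) \<phi>"
    and linear_psi_M: "Vector_Spaces.linear sM sM \<psi>\<^sub>M"
    and linear_omega_M: "Vector_Spaces.linear sM sM \<omega>\<^sub>M"
    and psi_omega_M: "\<psi>\<^sub>M (\<omega>\<^sub>M m) = \<omega>\<^sub>M (\<psi>\<^sub>M m)"
    and psi_phi:
      "sweedler (tensor_rel sM sA) (\<lambda>m0 m1. tens (tensor_rel sM sA) (\<psi>\<^sub>M m0, \<psi>\<^sub>A m1)) (\<phi> m) = \<phi> (\<psi>\<^sub>M m)"
    and omega_phi:
      "sweedler (tensor_rel sM sA) (\<lambda>m0 m1. tens (tensor_rel sM sA) (\<omega>\<^sub>M m0, \<omega>\<^sub>A m1)) (\<phi> m) = \<phi> (\<omega>\<^sub>M m)"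
    \<comment> \<open>\<open>(\<omega>\<^sub>M \<otimes> \<Delta>) \<phi> = (\<phi> \<otimes> \<psi>\<^sub>A) \<phi>\<close> in \<open>M \<otimes> A \<otimes> A\<close>\<close>
    and bihom_coassoc:
      "let W = tensor_rel3 sM sA sA in
       sweedler W (\<lambda>m0 m1. sweedler W (\<lambda>a1 a2. tens W (\<omega>\<^sub>M m0, a1, a2)) (\<Delta> m1)) (\<phi> m) =
       sweedler W (\<lambda>m0 m1. sweedler W (\<lambda>n0 n1. tens W (n0, n1, \<psi>\<^sub>A m1)) (\<phi> m0)) (\<phi> m)"

locale right_infBH_Hopf_module =
  right_bihom_module sA mu \<alpha>\<^sub>A \<beta>\<^sub>A sM act \<alpha>\<^sub>M \<beta>\<^sub>M +
  right_bihom_comodule sA \<Delta> \<psi>\<^sub>A \<omega>\<^sub>A sM \<phi> \<psi>\<^sub>M \<omega>\<^sub>M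
  for lam :: "'k::field"
    and sA :: "'k \<Rightarrow> 'a::ab_group_add \<Rightarrow> 'a" and mu \<Delta> \<alpha>\<^sub>A \<beta>\<^sub>A \<psi>\<^sub>A \<omega>\<^sub>A
    and sM :: "'k \<Rightarrow> 'm::ab_group_add \<Rightarrow> 'm" and act \<phi> \<alpha>\<^sub>M \<beta>\<^sub>M \<psi>\<^sub>M \<omega>\<^sub>M +
  assumes alpha_psi_M: "\<alpha>\<^sub>M (\<psi>\<^sub>M m) = \<psi>\<^sub>M (\<alpha>\<^sub>M m)"
    and alpha_omega_M: "\<alpha>\<^sub>M (\<omega>\<^sub>M m) = \<omega>\<^sub>M (\<alpha>\<^sub>M m)"
    and beta_psi_M: "\<beta>\<^sub>M (\<psi>\<^sub>M m) = \<psi>\<^sub>M (\<beta>\<^sub>M m)"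
    and beta_omega_M: "\<beta>\<^sub>M (\<omega>\<^sub>M m) = \<omega>\<^sub>M (\<beta>\<^sub>M m)"
    and phi_act:
      "let W = tensor_rel sM sA in
       \<phi> (act m a) =
         qadd W
           (qadd W
             (sweedler W (\<lambda>a1 a2. tens W (act (\<omega>\<^sub>M m) a1, \<beta>\<^sub>A a2)) (\<Delta> a))
             (sweedler W (\<lambda>m0 m1. tens W (\<alpha>\<^sub>M m0, mu m1 (\<psi>\<^sub>A a))) (\<phi> m)))
           (qscale W lam (tens W (\<alpha>\<^sub>M (\<omega>\<^sub>M m), \<beta>\<^sub>A (\<psi>\<^sub>A a))))"

definition coaction_r ::
  "('k::field \<Rightarrow> 'a::ab_group_add \<Rightarrow> 'a) \<Rightarrow> ('a \<Rightarrow> 'a) \<Rightarrow> ('a \<times> 'a \<Rightarrow>\<^sub>0 'k) set \<Rightarrow>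
   ('k \<Rightarrow> 'm::ab_group_add \<Rightarrow> 'm) \<Rightarrow> ('m \<Rightarrow> 'a \<Rightarrow> 'm) \<Rightarrow> ('m \<Rightarrow> 'm) \<Rightarrow> ('m \<Rightarrow> 'm) \<Rightarrow>
   'm \<Rightarrow> ('m \<times> 'a \<Rightarrow>\<^sub>0 'k) set" where
  "coaction_r sA \<beta>\<^sub>A r sM act \<alpha>\<^sub>M \<omega>\<^sub>M m =
     sweedler (tensor_rel sM sA)
       (\<lambda>r1 r2. tens (tensor_rel sM sA) (act (\<omega>\<^sub>M (inv \<alpha>\<^sub>M m)) r1, \<beta>\<^sub>A r2)) r"

end

theory Submission
  imports Defs
begin

text \<open>
  Write \<open>r = x\<^sub>i \<otimes> y\<^sub>i\<close> (sum over \<open>i\<close>).  Both sides of every identity are then sums of pure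
  tensors, and invariance of \<open>r\<close> allows replacing \<open>(x\<^sub>i, y\<^sub>i)\<close> by \<open>(f x\<^sub>i, f y\<^sub>i)\<close> for
  \<open>f \<in> {\<alpha>, \<beta>, \<psi>, \<omega>}\<close>, so that no inverse of \<open>\<alpha>\<close> or \<open>\<beta>\<close> acting on \<open>x\<^sub>i\<close> or \<open>y\<^sub>i\<close> survives.
  Since \<open>(m \<triangleleft> a) \<triangleleft> b = \<alpha>(m) \<triangleleft> a \<beta>\<inverse>(b)\<close>, coassociativity at \<open>m\<close> becomes the image of the
  anti-quasitriangular equation under \<open>a \<otimes> b \<otimes> c \<mapsto> u \<triangleleft> a \<otimes> \<beta>(b) \<otimes> \<beta>(c)\<close> with
  \<open>u = \<omega>\<^sup>2\<alpha>\<inverse>(m)\<close>; compatibility with the action needs only the invariance of \<open>r\<close> under \<open>\<beta>\<close>.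
\<close>

section \<open>Multilinear maps modulo a subspace\<close>

text \<open>Linearity is asked of a representative \<open>f v\<close> in the free space, up to
  \<open>W\<close>, not of its coset. Computations then use ordinary sums in the free space and
  avoid the arbitrary choice made by \<open>rep\<close>.\<close>

definition linear_mod ::
  "('k::field \<Rightarrow> 'v::ab_group_add \<Rightarrow> 'v) \<Rightarrow> ('y \<Rightarrow>\<^sub>0 'k) set \<Rightarrow> ('v \<Rightarrow> ('y \<Rightarrow>\<^sub>0 'k)) \<Rightarrow> bool" where
  "linear_mod s W f \<longleftrightarrow>
     (\<forall>v v'. f (v + v') - f v - f v' \<in> W) \<and> (\<forall>c v. f (s c v) - free_scale c (f v) \<in> W)"

definition bilinear_mod ::
  "('k::field \<Rightarrow> 'v::ab_group_add \<Rightarrow> 'v) \<Rightarrow> ('k \<Rightarrow> 'w::ab_group_add \<Rightarrow> 'w) \<Rightarrow>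
   ('y \<Rightarrow>\<^sub>0 'k) set \<Rightarrow> ('v \<Rightarrow> 'w \<Rightarrow> ('y \<Rightarrow>\<^sub>0 'k)) \<Rightarrow> bool" where
  "bilinear_mod sV sW W B \<longleftrightarrow> (\<forall>w. linear_mod sV W (\<lambda>v. B v w)) \<and> (\<forall>v. linear_mod sW W (B v))"

section \<open>Arithmetic of cosets through representatives\<close>

lemma qadd_coset: "free.subspace W \<Longrightarrow> qadd W (coset W p) (coset W q) = coset W (p + q)"
  using free.subspace_add[OF _ rep_coset rep_coset, of W p q]
  by (simp add: qadd_def coset_eq_iff algebra_simps)

lemma qdiff_coset: "free.subspace W \<Longrightarrow> qdiff W (coset W p) (coset W q) = coset W (p - q)"
  using free.subspace_diff[OF _ rep_coset rep_coset, of W p q]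
  by (simp add: qdiff_def coset_eq_iff algebra_simps)

lemma qscale_coset: "free.subspace W \<Longrightarrow> qscale W c (coset W p) = coset W (free_scale c p)"
  using free.subspace_scale[OF _ rep_coset, where c = c]
  by (simp add: qscale_def coset_eq_iff free.scale_right_diff_distrib)

lemma coset_diff_cong:
  "free.subspace W \<Longrightarrow> coset W p = coset W p' \<Longrightarrow> coset W q = coset W q' \<Longrightarrow>
    coset W (p - q) = coset W (p' - q')"
  by (metis qdiff_coset)

lemma linear_into_quotient_coset:
  "free.subspace W \<Longrightarrow> linear_into_quotient s W (\<lambda>v. coset W (f v)) \<longleftrightarrow> linear_mod s W f"
  by (auto simp: linear_into_quotient_def linear_mod_def quotient_space_def qadd_coset qscale_coset
      coset_eq_iff diff_diff_eq)

section \<open>Closure properties of linearity modulo a subspace\<close>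

lemma linear_mod_zero: "free.subspace W \<Longrightarrow> linear_mod s W (\<lambda>v. 0)"
  by (simp add: linear_mod_def free.subspace_0)

lemma linear_mod_add:
  assumes W: "free.subspace W" and f: "linear_mod s W f" and g: "linear_mod s W g"
  shows "linear_mod s W (\<lambda>v. f v + g v)"
  unfolding linear_mod_def
proof safe
  fix v v'
  have "(f (v + v') - f v - f v') + (g (v + v') - g v - g v') \<in> W"
    using f g by (intro free.subspace_add[OF W]) (auto simp: linear_mod_def)
  then show "f (v + v') + g (v + v') - (f v + g v) - (f v' + g v') \<in> W"
    by (simp add: algebra_simps)
next
  fix c v
  have "(f (s c v) - free_scale c (f v)) + (g (s c v) - free_scale c (g v)) \<in> W"
    using f g by (intro free.subspace_add[OF W]) (auto simp: linear_mod_def)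
  then show "f (s c v) + g (s c v) - free_scale c (f v + g v) \<in> W"
    by (simp add: algebra_simps free.scale_right_distrib)
qed

lemma linear_mod_scale:
  assumes W: "free.subspace W" and f: "linear_mod s W f"
  shows "linear_mod s W (\<lambda>v. free_scale d (f v))"
  unfolding linear_mod_def
proof safe
  fix v v'
  have "free_scale d (f (v + v') - f v - f v') \<in> W"
    using f by (intro free.subspace_scale[OF W]) (auto simp: linear_mod_def)
  then show "free_scale d (f (v + v')) - free_scale d (f v) - free_scale d (f v') \<in> W"
    by (simp add: free.scale_right_diff_distrib)
next
  fix c v
  have "free_scale d (f (s c v) - free_scale c (f v)) \<in> W"
    using f by (intro free.subspace_scale[OF W]) (auto simp: linear_mod_def)
  then show "free_scale d (f (s c v)) - free_scale c (free_scale d (f v)) \<in> W"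
    by (simp add: free.scale_right_diff_distrib mult.commute)
qed

lemma linear_mod_diff:
  assumes "free.subspace W" "linear_mod s W f" "linear_mod s W g"
  shows "linear_mod s W (\<lambda>v. f v - g v)"
  using linear_mod_add[OF assms(1,2) linear_mod_scale[OF assms(1,3), of "- 1"]] by simp

text \<open>A sum over an infinite \<open>I\<close> is 0 by convention, so that case holds as well
  and finiteness of index sets need not be tracked.\<close>

lemma linear_mod_sum:
  assumes W: "free.subspace W" and f: "\<And>i. linear_mod s W (f i)"
  shows "linear_mod s W (\<lambda>v. \<Sum>i\<in>I. f i v)"
  by (induction I rule: infinite_finite_induct)
     (simp_all add: linear_mod_zero[OF W] linear_mod_add[OF W] f)

section \<open>Dependence of pure tensors on each slot\<close>

text \<open>After rewriting with the two equations for \<open>g\<close>, both differences are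
  generators of the relations. Linearity of \<open>g\<close> is stated as equations so that the
  simplifier can discharge it.\<close>

lemma linear_mod_gen:
  assumes "\<And>v v'. g (v + v') = g v + g v'" "\<And>c v. g (s c v) = sV c (g v)"
  shows "linear_mod s (tensor_rel sV sW) (\<lambda>v. free_gen (g v, w))"
  unfolding linear_mod_def tensor_rel_def assms by (intro conjI allI; rule free.span_base; blast)

lemma linear_mod_gen':
  assumes "\<And>v v'. g (v + v') = g v + g v'" "\<And>c v. g (s c v) = sW c (g v)"
  shows "linear_mod s (tensor_rel sV sW) (\<lambda>v. free_gen (u, g v))"
  unfolding linear_mod_def tensor_rel_def assms by (intro conjI allI; rule free.span_base; blast)

lemma linear_mod_gen3:
  assumes "\<And>v v'. g (v + v') = g v + g v'" "\<And>c v. g (s c v) = sU c (g v)"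
  shows "linear_mod s (tensor_rel3 sU sV sW) (\<lambda>v. free_gen (g v, x, y))"
  unfolding linear_mod_def tensor_rel3_def assms
  apply (intro conjI allI; rule free.span_base)
   \<comment> \<open>The union of the six generating families nests to the left. The two chains
     select the first family (additivity in the first slot) and the fourth (its scalars).\<close>
   apply (rule UnI1, rule UnI1, rule UnI1, rule UnI1, rule UnI1, blast)
  apply (rule UnI1, rule UnI1, rule UnI2, blast)
  done

lemma linear_mod_gen3':
  assumes "\<And>v v'. g (v + v') = g v + g v'" "\<And>c v. g (s c v) = sV c (g v)"
  shows "linear_mod s (tensor_rel3 sU sV sW) (\<lambda>v. free_gen (x, g v, y))"
  unfolding linear_mod_def tensor_rel3_def assms
  apply (intro conjI allI; rule free.span_base)
   apply (rule UnI1, rule UnI1, rule UnI1, rule UnI1, rule UnI2, blast)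
  apply (rule UnI1, rule UnI2, blast)
  done

lemma linear_mod_gen3'':
  assumes "\<And>v v'. g (v + v') = g v + g v'" "\<And>c v. g (s c v) = sW c (g v)"
  shows "linear_mod s (tensor_rel3 sU sV sW) (\<lambda>v. free_gen (x, y, g v))"
  unfolding linear_mod_def tensor_rel3_def assms
  apply (intro conjI allI; rule free.span_base)
   apply (rule UnI1, rule UnI1, rule UnI1, rule UnI2, blast)
  apply (rule UnI2, blast)
  done

lemmas linear_mod_intros =
  linear_mod_add linear_mod_diff linear_mod_scale linear_mod_sum
  linear_mod_gen linear_mod_gen' linear_mod_gen3 linear_mod_gen3' linear_mod_gen3''
  subspace_tensor_rel subspace_tensor_rel3

section \<open>Linear extension and evaluation of Sweedler sums\<close>

lemma free_extend_add: "free_extend h (p + q) = free_extend h p + free_extend h q"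
  and free_extend_diff: "free_extend h (p - q) = free_extend h p - free_extend h q"
  and free_extend_scale: "free_extend h (free_scale c p) = free_scale c (free_extend h p)"
  and free_extend_zero: "free_extend h 0 = 0"
  and free_extend_sum: "free_extend h (\<Sum>i\<in>I. f i) = (\<Sum>i\<in>I. free_extend h (f i))"
proof -
  interpret E: Vector_Spaces.linear free_scale free_scale "free_extend h"
    by (rule linear_free_extend)
  show "free_extend h (p + q) = free_extend h p + free_extend h q"
    and "free_extend h (p - q) = free_extend h p - free_extend h q"
    and "free_extend h (free_scale c p) = free_scale c (free_extend h p)"
    and "free_extend h 0 = 0"
    and "free_extend h (\<Sum>i\<in>I. f i) = (\<Sum>i\<in>I. free_extend h (f i))"
    by (rule E.add E.diff E.scale E.zero E.sum)+
qed

lemmas free_extend_simps = free_extend_add free_extend_diff free_extend_scale free_extend_zero free_extend_sum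

text \<open>\<open>rep (coset W (B v w))\<close> differs from \<open>B v w\<close> by an element of
  \<open>W\<close>, and linear combinations of such differences stay in \<open>W\<close>. This
  evaluates Sweedler notation on any chosen representatives.\<close>

lemma sweedler_coset_eq:
  assumes W: "free.subspace W" and B: "bilinear_mod sV sW W B"
  shows "sweedler W (\<lambda>v w. coset W (B v w)) (coset (tensor_rel sV sW) p) =
    coset W (free_extend (\<lambda>(v, w). B v w) p)"
proof -
  have "sweedler W (\<lambda>v w. coset W (B v w)) (coset (tensor_rel sV sW) p) =
      coset W (free_extend (\<lambda>(v, w). rep (coset W (B v w))) p)"
    using B by (intro sweedler_coset[OF W]) (auto simp: linear_into_quotient_coset[OF W] bilinear_mod_def)
  also have "\<dots> = coset W (free_extend (\<lambda>(v, w). B v w) p)"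
    unfolding coset_eq_iff[OF W] free_extend_def sum_subtractf[symmetric] free.scale_right_diff_distrib[symmetric]
    by (intro free.subspace_sum[OF W] free.subspace_scale[OF W]) (auto intro: rep_coset[OF W])
  finally show ?thesis .
qed

text \<open>Trilinearity modulo \<open>W\<close> makes the linear extension of \<open>T\<close> send
  every trilinear relation into \<open>W\<close>, so it descends to the triple tensor product. It
  serves to transport the anti-quasitriangular equation to another space.\<close>

lemma coset_free_extend_cong3:
  assumes W: "free.subspace W"
    and T: "\<And>v w. linear_mod sU W (\<lambda>u. T u v w)" "\<And>u w. linear_mod sV W (\<lambda>v. T u v w)"
      "\<And>u v. linear_mod sW W (\<lambda>w. T u v w)"
    and eq: "coset (tensor_rel3 sU sV sW) p = coset (tensor_rel3 sU sV sW) q"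
  shows "coset W (free_extend (\<lambda>(u, v, w). T u v w) p) = coset W (free_extend (\<lambda>(u, v, w). T u v w) q)"
proof -
  let ?E = "free_extend (\<lambda>(u, v, w). T u v w)"
  have "free.subspace (?E -` W)"
    using W by (auto simp: free.subspace_def free_extend_simps)
  then have "tensor_rel3 sU sV sW \<subseteq> ?E -` W"
    unfolding tensor_rel3_def
    using T by (intro free.span_minimal) (auto simp: free_extend_simps linear_mod_def)
  then show ?thesis
    using eq by (auto simp: coset_eq_iff[OF subspace_tensor_rel3] coset_eq_iff[OF W] free_extend_simps)
qed

text \<open>The support of a representative serves as index set, and each coefficient is absorbed
  into the first factor, so that later sums carry no scalars.\<close>

lemma quotient_space_tensor_sum:
  fixes T :: "('v::ab_group_add \<times> 'w::ab_group_add \<Rightarrow>\<^sub>0 'k::field) set"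
  assumes "T \<in> quotient_space (tensor_rel sV sW)"
  obtains I :: "('v \<times> 'w) set" and x y
  where "T = coset (tensor_rel sV sW) (\<Sum>i\<in>I. free_gen (x i, y i))"
proof -
  obtain p where p: "T = coset (tensor_rel sV sW) p"
    using assms by (auto simp: quotient_space_def)
  have p_eq: "p = (\<Sum>i\<in>Poly_Mapping.keys p. free_scale (Poly_Mapping.lookup p i) (free_gen i))"
  proof (rule poly_mapping_eqI)
    fix k
    show "Poly_Mapping.lookup p k = Poly_Mapping.lookup (\<Sum>i\<in>Poly_Mapping.keys p. free_scale (Poly_Mapping.lookup p i) (free_gen i)) k"
      by (simp add: lookup_sum free_gen_def lookup_single when_def if_distrib in_keys_iff sum.delta cong: if_cong)
  qed
  have "T = coset (tensor_rel sV sW)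
      (\<Sum>i\<in>Poly_Mapping.keys p. free_gen (sV (Poly_Mapping.lookup p i) (fst i), snd i))"
    (is "_ = coset ?W ?q")
  proof -
    have "?q - p \<in> ?W"
      by (subst p_eq, unfold sum_subtractf[symmetric], rule free.subspace_sum[OF subspace_tensor_rel])
        (use linear_mod_gen[of "\<lambda>v. v" sV sV sW] in \<open>auto simp: linear_mod_def\<close>)
    then show ?thesis
      unfolding p by (metis coset_eq_iff subspace_tensor_rel)
  qed
  then show ?thesis
    by (rule that[of "\<lambda>i. sV (Poly_Mapping.lookup p i) (fst i)" snd "Poly_Mapping.keys p"])
qed


section \<open>The coaction on a module\<close>

text \<open>A decomposition of \<open>r\<close> is fixed so that every Sweedler expression becomes a
  sum over \<open>I\<close>. The action of \<open>one\<close> arises only from the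
  \<open>lam\<close> term of the comultiplication, hence the guard in
  \<open>act_one\<close>.\<close>

locale anti_qt_module =
  anti_qt_bialgebra sA mu \<alpha>\<^sub>A \<beta>\<^sub>A one lam \<psi>\<^sub>A \<omega>\<^sub>A r +
  right_bihom_module sA mu \<alpha>\<^sub>A \<beta>\<^sub>A sM act \<alpha>\<^sub>M \<beta>\<^sub>M
  for sA :: "'k::field \<Rightarrow> 'a::ab_group_add \<Rightarrow> 'a" and mu \<alpha>\<^sub>A \<beta>\<^sub>A one lam \<psi>\<^sub>A \<omega>\<^sub>A r
    and sM :: "'k \<Rightarrow> 'm::ab_group_add \<Rightarrow> 'm" and act \<alpha>\<^sub>M \<beta>\<^sub>M +
  fixes \<psi>\<^sub>M \<omega>\<^sub>M :: "'m \<Rightarrow> 'm"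
    and I :: "'i set" and x y :: "'i \<Rightarrow> 'a"
  assumes r_sum: "r = coset (tensor_rel sA sA) (\<Sum>i\<in>I. free_gen (x i, y i))"
    and bij_alpha_M: "bij \<alpha>\<^sub>M"
    and linear_psi_M: "Vector_Spaces.linear sM sM \<psi>\<^sub>M"
    and linear_omega_M: "Vector_Spaces.linear sM sM \<omega>\<^sub>M"
    and alpha_omega_M: "\<alpha>\<^sub>M (\<omega>\<^sub>M m) = \<omega>\<^sub>M (\<alpha>\<^sub>M m)"
    and omega_act: "\<omega>\<^sub>M (act m a) = act (\<omega>\<^sub>M m) (\<omega>\<^sub>A a)"
    and alpha_psi_M: "\<alpha>\<^sub>M (\<psi>\<^sub>M m) = \<psi>\<^sub>M (\<alpha>\<^sub>M m)"
    and beta_psi_M: "\<beta>\<^sub>M (\<psi>\<^sub>M m) = \<psi>\<^sub>M (\<beta>\<^sub>M m)"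
    and beta_omega_M: "\<beta>\<^sub>M (\<omega>\<^sub>M m) = \<omega>\<^sub>M (\<beta>\<^sub>M m)"
    and psi_omega_M: "\<psi>\<^sub>M (\<omega>\<^sub>M m) = \<omega>\<^sub>M (\<psi>\<^sub>M m)"
    and psi_act: "\<psi>\<^sub>M (act m a) = act (\<psi>\<^sub>M m) (\<psi>\<^sub>A a)"
    and act_one: "lam \<noteq> 0 \<Longrightarrow> act m one = \<alpha>\<^sub>M m"
begin

abbreviation \<Delta> where "\<Delta> \<equiv> comult_r sA mu \<alpha>\<^sub>A \<beta>\<^sub>A one lam \<psi>\<^sub>A \<omega>\<^sub>A r"
abbreviation \<phi> where "\<phi> \<equiv> coaction_r sA \<beta>\<^sub>A r sM act \<alpha>\<^sub>M \<omega>\<^sub>M"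

lemma inv_simps [simp]:
  "\<alpha>\<^sub>A (inv \<alpha>\<^sub>A a) = a" "inv \<alpha>\<^sub>A (\<alpha>\<^sub>A a) = a" "\<beta>\<^sub>A (inv \<beta>\<^sub>A a) = a" "inv \<beta>\<^sub>A (\<beta>\<^sub>A a) = a"
  "\<alpha>\<^sub>M (inv \<alpha>\<^sub>M m) = m" "inv \<alpha>\<^sub>M (\<alpha>\<^sub>M m) = m"
  using bij_alpha bij_beta bij_alpha_M
  by (simp_all add: bij_is_surj surj_f_inv_f bij_is_inj inv_f_f)

lemma inv_eq_iff:
  "inv \<alpha>\<^sub>A a = b \<longleftrightarrow> a = \<alpha>\<^sub>A b" "inv \<beta>\<^sub>A a = b \<longleftrightarrow> a = \<beta>\<^sub>A b" "inv \<alpha>\<^sub>M m = n \<longleftrightarrow> m = \<alpha>\<^sub>M n"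
  by (metis inv_simps)+

lemma linear_simps [simp]:
  "mu (a + a') b = mu a b + mu a' b" "mu a (b + b') = mu a b + mu a b'"
  "mu (sA c a) b = sA c (mu a b)" "mu a (sA c b) = sA c (mu a b)"
  "act (m + m') b = act m b + act m' b" "act m (b + b') = act m b + act m b'"
  "act (sM c m) b = sM c (act m b)" "act m (sA c b) = sM c (act m b)"
  "\<alpha>\<^sub>A (a + a') = \<alpha>\<^sub>A a + \<alpha>\<^sub>A a'" "\<alpha>\<^sub>A (sA c a) = sA c (\<alpha>\<^sub>A a)"
  "\<beta>\<^sub>A (a + a') = \<beta>\<^sub>A a + \<beta>\<^sub>A a'" "\<beta>\<^sub>A (sA c a) = sA c (\<beta>\<^sub>A a)"
  "\<psi>\<^sub>A (a + a') = \<psi>\<^sub>A a + \<psi>\<^sub>A a'" "\<psi>\<^sub>A (sA c a) = sA c (\<psi>\<^sub>A a)"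
  "\<omega>\<^sub>A (a + a') = \<omega>\<^sub>A a + \<omega>\<^sub>A a'" "\<omega>\<^sub>A (sA c a) = sA c (\<omega>\<^sub>A a)"
  "\<alpha>\<^sub>M (m + m') = \<alpha>\<^sub>M m + \<alpha>\<^sub>M m'" "\<alpha>\<^sub>M (sM c m) = sM c (\<alpha>\<^sub>M m)"
  "\<psi>\<^sub>M (m + m') = \<psi>\<^sub>M m + \<psi>\<^sub>M m'" "\<psi>\<^sub>M (sM c m) = sM c (\<psi>\<^sub>M m)"
  "\<omega>\<^sub>M (m + m') = \<omega>\<^sub>M m + \<omega>\<^sub>M m'" "\<omega>\<^sub>M (sM c m) = sM c (\<omega>\<^sub>M m)"
  using bilinear_mu bilinear_act linear_alpha linear_beta linear_psi linear_omega
    linear_alpha_M linear_psi_M linear_omega_M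
  by (simp_all add: bilinear_over_def Vector_Spaces.linear_iff)

lemma linear_inv_simps [simp]:
  "inv \<alpha>\<^sub>A (a + a') = inv \<alpha>\<^sub>A a + inv \<alpha>\<^sub>A a'" "inv \<alpha>\<^sub>A (sA c a) = sA c (inv \<alpha>\<^sub>A a)"
  "inv \<beta>\<^sub>A (a + a') = inv \<beta>\<^sub>A a + inv \<beta>\<^sub>A a'" "inv \<beta>\<^sub>A (sA c a) = sA c (inv \<beta>\<^sub>A a)"
  "inv \<alpha>\<^sub>M (m + m') = inv \<alpha>\<^sub>M m + inv \<alpha>\<^sub>M m'" "inv \<alpha>\<^sub>M (sM c m) = sM c (inv \<alpha>\<^sub>M m)"
  by (simp_all add: inv_eq_iff)

text \<open>Oriented for rewriting: inverses move outward past \<psi> and \<omega>, while inverses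
  of \<alpha> move inward past \<beta>, products and actions.\<close>

lemma inv_commute:
  "\<omega>\<^sub>A (inv \<alpha>\<^sub>A a) = inv \<alpha>\<^sub>A (\<omega>\<^sub>A a)" "\<psi>\<^sub>A (inv \<beta>\<^sub>A a) = inv \<beta>\<^sub>A (\<psi>\<^sub>A a)"
  "inv \<alpha>\<^sub>A (\<beta>\<^sub>A a) = \<beta>\<^sub>A (inv \<alpha>\<^sub>A a)" "inv \<alpha>\<^sub>A (mu a b) = mu (inv \<alpha>\<^sub>A a) (inv \<alpha>\<^sub>A b)"
  "\<omega>\<^sub>M (inv \<alpha>\<^sub>M m) = inv \<alpha>\<^sub>M (\<omega>\<^sub>M m)" "\<psi>\<^sub>M (inv \<alpha>\<^sub>M m) = inv \<alpha>\<^sub>M (\<psi>\<^sub>M m)"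
  "inv \<alpha>\<^sub>M (act m a) = act (inv \<alpha>\<^sub>M m) (inv \<alpha>\<^sub>A a)"
  by (metis inv_simps omega_alpha psi_beta alpha_beta alpha_mu alpha_omega_M alpha_psi_M alpha_act)+

section \<open>Sums over one or two copies of \<open>r\<close>\<close>

lemma sweedler_r:
  assumes "free.subspace W" "bilinear_mod sA sA W B"
  shows "sweedler W (\<lambda>v w. coset W (B v w)) r = coset W (\<Sum>i\<in>I. B (x i) (y i))"
  using sweedler_coset_eq[OF assms] by (simp add: r_sum free_extend_simps)

text \<open>Invariance says that the pairs \<open>(f (x i), f (y i))\<close> decompose
  \<open>r\<close> too; \<open>B\<close> is evaluated on both decompositions. With an inverse of
  \<open>f\<close> built into \<open>B\<close>, the inverse cancels on the left side.\<close>

lemma r_invariant: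
  assumes W: "free.subspace W" and f: "invariant_tensor sA r f" "Vector_Spaces.linear sA sA f"
    and B: "bilinear_mod sA sA W B"
  shows "coset W (\<Sum>i\<in>I. B (f (x i)) (f (y i))) = coset W (\<Sum>i\<in>I. B (x i) (y i))"
proof -
  have "bilinear_mod sA sA (tensor_rel sA sA) (\<lambda>v w. free_gen (f v, f w))"
    using f(2) by (simp add: bilinear_mod_def linear_mod_intros Vector_Spaces.linear_iff)
  then have "r = coset (tensor_rel sA sA) (\<Sum>i\<in>I. free_gen (f (x i), f (y i)))"
    using f(1) by (simp add: invariant_tensor_def tens_def sweedler_r subspace_tensor_rel)
  then have "sweedler W (\<lambda>v w. coset W (B v w)) r = coset W (\<Sum>i\<in>I. B (f (x i)) (f (y i)))"
    using sweedler_coset_eq[OF W B] by (simp add: free_extend_simps)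
  then show ?thesis
    using sweedler_r[OF W B] by simp
qed

text \<open>The first copy is summed into the bilinear map, so that the invariance of a single copy
  applies to the second one; exchanging the sums restores the order.\<close>

lemma r_invariant2:
  assumes W: "free.subspace W" and f: "invariant_tensor sA r f" "Vector_Spaces.linear sA sA f"
    and B: "\<And>a b. bilinear_mod sA sA W (B a b)"
  shows "coset W (\<Sum>i\<in>I. \<Sum>j\<in>I. B (x i) (y i) (f (x j)) (f (y j))) =
    coset W (\<Sum>i\<in>I. \<Sum>j\<in>I. B (x i) (y i) (x j) (y j))"
proof -
  have "bilinear_mod sA sA W (\<lambda>v w. \<Sum>i\<in>I. B (x i) (y i) v w)"
    using B by (auto simp: bilinear_mod_def intro!: linear_mod_sum[OF W])
  from r_invariant[OF W f this] show ?thesis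
    by (subst (1 2) sum.swap)
qed

lemma comult_eq:
  "\<Delta> a = coset (tensor_rel sA sA)
     ((\<Sum>i\<in>I. free_gen (mu (\<omega>\<^sub>A (inv \<alpha>\<^sub>A a)) (x i), \<beta>\<^sub>A (y i))) -
      (\<Sum>i\<in>I. free_gen (\<alpha>\<^sub>A (x i), mu (y i) (\<psi>\<^sub>A (inv \<beta>\<^sub>A a)))) -
      free_scale lam (free_gen (one, \<psi>\<^sub>A a)))"
  by (simp add: comult_r_def tens_def Let_def sweedler_r bilinear_mod_def linear_mod_intros
      qdiff_coset qscale_coset)

lemma coaction_eq:
  "\<phi> m = coset (tensor_rel sM sA) (\<Sum>i\<in>I. free_gen (act (\<omega>\<^sub>M (inv \<alpha>\<^sub>M m)) (x i), \<beta>\<^sub>A (y i)))"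
  by (simp add: coaction_r_def tens_def sweedler_r bilinear_mod_def linear_mod_intros)

lemma anti_quasitriangular_sum:
  "coset (tensor_rel3 sA sA sA)
     ((\<Sum>i\<in>I. \<Sum>j\<in>I. free_gen (mu (\<omega>\<^sub>A (x i)) (x j), \<beta>\<^sub>A (y j), \<alpha>\<^sub>A (\<psi>\<^sub>A (y i)))) -
      (\<Sum>i\<in>I. \<Sum>j\<in>I. free_gen (\<alpha>\<^sub>A (x i), mu (y i) (x j), \<beta>\<^sub>A (y j))) +
      (\<Sum>i\<in>I. \<Sum>j\<in>I. free_gen (\<beta>\<^sub>A (\<omega>\<^sub>A (x i)), \<alpha>\<^sub>A (x j), mu (y j) (\<psi>\<^sub>A (y i))))) =
   coset (tensor_rel3 sA sA sA)
     (free_scale (- lam) (\<Sum>i\<in>I. free_gen (\<omega>\<^sub>A (x i), one, \<psi>\<^sub>A (y i))))"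
  using anti_quasitriangular
  by (simp add: Let_def tens_def sweedler_r bilinear_mod_def linear_mod_intros
      qdiff_coset qadd_coset qscale_coset)

section \<open>Comodule axioms\<close>

lemma linear_comult: "linear_into_quotient sA (tensor_rel sA sA) \<Delta>"
  unfolding comult_eq
  by (simp add: linear_into_quotient_coset linear_mod_intros)

lemma linear_coaction: "linear_into_quotient sM (tensor_rel sM sA) \<phi>"
  unfolding coaction_eq
  by (simp add: linear_into_quotient_coset linear_mod_intros)

text \<open>Since \<psi> respects the action and commutes with \<beta>, it moves onto
  \<open>m\<close> and onto both factors of \<open>r\<close>, where invariance removes it. The
  argument for \<omega> is the same.\<close>

lemma psi_coaction:
  "sweedler (tensor_rel sM sA) (\<lambda>m0 m1. tens (tensor_rel sM sA) (\<psi>\<^sub>M m0, \<psi>\<^sub>A m1)) (\<phi> m) = \<phi> (\<psi>\<^sub>M m)"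
  using r_invariant[OF subspace_tensor_rel r_psi linear_psi,
    of sM sA "\<lambda>a b. free_gen (act (\<omega>\<^sub>M (inv \<alpha>\<^sub>M (\<psi>\<^sub>M m))) a, \<beta>\<^sub>A b)"]
  by (simp add: coaction_eq tens_def sweedler_coset_eq bilinear_mod_def linear_mod_intros
      free_extend_simps psi_act psi_beta psi_omega_M inv_commute)

lemma omega_coaction:
  "sweedler (tensor_rel sM sA) (\<lambda>m0 m1. tens (tensor_rel sM sA) (\<omega>\<^sub>M m0, \<omega>\<^sub>A m1)) (\<phi> m) = \<phi> (\<omega>\<^sub>M m)"
  using r_invariant[OF subspace_tensor_rel r_omega linear_omega,
    of sM sA "\<lambda>a b. free_gen (act (\<omega>\<^sub>M (inv \<alpha>\<^sub>M (\<omega>\<^sub>M m))) a, \<beta>\<^sub>A b)"]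
  by (simp add: coaction_eq tens_def sweedler_coset_eq bilinear_mod_def linear_mod_intros
      free_extend_simps omega_act omega_beta inv_commute)

lemma act_act: "act (act m a) b = act (\<alpha>\<^sub>M m) (mu a (inv \<beta>\<^sub>A b))"
  by (simp add: bihom_act)

text \<open>The right side reduces to \<open>P\<close> and the left side to
  \<open>Q - R - free_scale lam S\<close>; these agree because the anti-quasitriangular equation
  becomes \<open>P - Q + R = - lam S\<close> modulo the relations.\<close>

lemma coaction_coassoc:
  "sweedler (tensor_rel3 sM sA sA)
     (\<lambda>m0 m1. sweedler (tensor_rel3 sM sA sA)
       (\<lambda>a1 a2. tens (tensor_rel3 sM sA sA) (\<omega>\<^sub>M m0, a1, a2)) (\<Delta> m1)) (\<phi> m) =
   sweedler (tensor_rel3 sM sA sA)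
     (\<lambda>m0 m1. sweedler (tensor_rel3 sM sA sA)
       (\<lambda>n0 n1. tens (tensor_rel3 sM sA sA) (n0, n1, \<psi>\<^sub>A m1)) (\<phi> m0)) (\<phi> m)"
proof -
  let ?W = "tensor_rel3 sM sA sA"
  \<comment> \<open>Each side applies \<omega> twice to \<open>m\<close>. On the right side \<alpha>
    is inverted twice, and \<open>act_act\<close> takes back one of these inverses.\<close>
  define u where "u = \<omega>\<^sub>M (\<omega>\<^sub>M (inv \<alpha>\<^sub>M m))"
  note W = subspace_tensor_rel3[of sM sA sA]
  note invar = r_invariant[OF W] r_invariant2[OF W]
  note lin = bilinear_mod_def linear_mod_intros
  \<comment> \<open>\<open>P\<close>, \<open>Q\<close>, \<open>R\<close>, \<open>S\<close> are the
    images of the four terms of the anti-quasitriangular equation, in their order there and without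
    signs or scalar.\<close>
  define P :: "'m \<times> 'a \<times> 'a \<Rightarrow>\<^sub>0 'k" where "P = (\<Sum>i\<in>I. \<Sum>j\<in>I. free_gen (act u (mu (\<omega>\<^sub>A (x i)) (x j)), \<beta>\<^sub>A (\<beta>\<^sub>A (y j)), \<beta>\<^sub>A (\<alpha>\<^sub>A (\<psi>\<^sub>A (y i)))))"
  define Q :: "'m \<times> 'a \<times> 'a \<Rightarrow>\<^sub>0 'k" where "Q = (\<Sum>i\<in>I. \<Sum>j\<in>I. free_gen (act u (\<alpha>\<^sub>A (x i)), \<beta>\<^sub>A (mu (y i) (x j)), \<beta>\<^sub>A (\<beta>\<^sub>A (y j))))"
  define R :: "'m \<times> 'a \<times> 'a \<Rightarrow>\<^sub>0 'k" where "R = (\<Sum>i\<in>I. \<Sum>j\<in>I. free_gen (act u (\<beta>\<^sub>A (\<omega>\<^sub>A (x i))), \<beta>\<^sub>A (\<alpha>\<^sub>A (x j)), \<beta>\<^sub>A (mu (y j) (\<psi>\<^sub>A (y i)))))"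
  define S :: "'m \<times> 'a \<times> 'a \<Rightarrow>\<^sub>0 'k" where "S = (\<Sum>i\<in>I. free_gen (act u (\<omega>\<^sub>A (x i)), \<beta>\<^sub>A one, \<beta>\<^sub>A (\<psi>\<^sub>A (y i))))"
  have aq: "coset ?W (P - Q + R) = coset ?W (free_scale (- lam) S)"
    using coset_free_extend_cong3[OF W _ _ _ anti_quasitriangular_sum,
        of "\<lambda>a b c. free_gen (act u a, \<beta>\<^sub>A b, \<beta>\<^sub>A c)"]
    by (simp add: linear_mod_intros free_extend_simps P_def Q_def R_def S_def
        del: free.scale_minus_left)

  have "sweedler ?W (\<lambda>m0 m1. sweedler ?W (\<lambda>n0 n1. tens ?W (n0, n1, \<psi>\<^sub>A m1)) (\<phi> m0)) (\<phi> m) =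
      coset ?W (\<Sum>i\<in>I. \<Sum>j\<in>I. free_gen
        (act u (mu (\<omega>\<^sub>A (inv \<alpha>\<^sub>A (x i))) (inv \<beta>\<^sub>A (x j))), \<beta>\<^sub>A (y j), \<psi>\<^sub>A (\<beta>\<^sub>A (y i))))"
    by (simp add: coaction_eq tens_def sweedler_coset_eq lin free_extend_simps act_act inv_commute
        omega_act u_def)
  \<comment> \<open>Invariance under \<alpha> in the first copy cancels the inverse at
    \<open>x i\<close> and leaves an \<alpha> at \<open>y i\<close>; next, \<beta> in the second
    copy does the same for \<open>x j\<close> and \<open>y j\<close>.\<close>
  also have "\<dots> = coset ?W (\<Sum>i\<in>I. \<Sum>j\<in>I. free_gen
        (act u (mu (\<omega>\<^sub>A (x i)) (inv \<beta>\<^sub>A (x j))), \<beta>\<^sub>A (y j), \<psi>\<^sub>A (\<beta>\<^sub>A (\<alpha>\<^sub>A (y i)))))"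
    using invar(1)[OF r_alpha linear_alpha, of "\<lambda>a b. \<Sum>j\<in>I. free_gen
        (act u (mu (\<omega>\<^sub>A (inv \<alpha>\<^sub>A a)) (inv \<beta>\<^sub>A (x j))), \<beta>\<^sub>A (y j), \<psi>\<^sub>A (\<beta>\<^sub>A b))"]
    by (simp add: lin)
  also have "\<dots> = coset ?W P"
    using invar(2)[OF r_beta linear_beta, of "\<lambda>a b c d. free_gen
        (act u (mu (\<omega>\<^sub>A a) (inv \<beta>\<^sub>A c)), \<beta>\<^sub>A d, \<psi>\<^sub>A (\<beta>\<^sub>A (\<alpha>\<^sub>A b)))"]
    by (simp add: lin P_def psi_beta psi_alpha)
  finally have rhs: "sweedler ?W (\<lambda>m0 m1. sweedler ?W (\<lambda>n0 n1. tens ?W (n0, n1, \<psi>\<^sub>A m1)) (\<phi> m0)) (\<phi> m) =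
      coset ?W P" .

  \<comment> \<open>\<open>Q'\<close> and \<open>R'\<close> are the product terms of the left side
    exactly as the expansion of the comultiplication at \<open>\<beta>\<^sub>A (y i)\<close>
    produces them.\<close>
  define Q' :: "'m \<times> 'a \<times> 'a \<Rightarrow>\<^sub>0 'k" where "Q' = (\<Sum>i\<in>I. \<Sum>j\<in>I. free_gen
    (act u (\<omega>\<^sub>A (x i)), mu (\<omega>\<^sub>A (inv \<alpha>\<^sub>A (\<beta>\<^sub>A (y i)))) (x j), \<beta>\<^sub>A (y j)))"
  define R' :: "'m \<times> 'a \<times> 'a \<Rightarrow>\<^sub>0 'k" where "R' = (\<Sum>i\<in>I. \<Sum>j\<in>I. free_gen
    (act u (\<omega>\<^sub>A (x i)), \<alpha>\<^sub>A (x j), mu (y j) (\<psi>\<^sub>A (y i))))"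
  \<comment> \<open>In the first copy \<omega> is stripped off and \<alpha> inserted to cancel its
    inverse; then \<beta> is inserted in the second copy, so that the middle factor becomes \<beta>
    of a product.\<close>
  have "coset ?W Q' = coset ?W (\<Sum>i\<in>I. \<Sum>j\<in>I. free_gen
      (act u (x i), mu (inv \<alpha>\<^sub>A (\<beta>\<^sub>A (y i))) (x j), \<beta>\<^sub>A (y j)))"
    using invar(1)[OF r_omega linear_omega, of "\<lambda>a b. \<Sum>j\<in>I. free_gen
        (act u a, mu (inv \<alpha>\<^sub>A (\<beta>\<^sub>A b)) (x j), \<beta>\<^sub>A (y j))"]
    by (simp add: lin Q'_def inv_commute omega_beta)
  also have "\<dots> = coset ?W (\<Sum>i\<in>I. \<Sum>j\<in>I. free_gen (act u (\<alpha>\<^sub>A (x i)), mu (\<beta>\<^sub>A (y i)) (x j), \<beta>\<^sub>A (y j)))"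
    using invar(1)[OF r_alpha linear_alpha, of "\<lambda>a b. \<Sum>j\<in>I. free_gen
        (act u a, mu (inv \<alpha>\<^sub>A (\<beta>\<^sub>A b)) (x j), \<beta>\<^sub>A (y j))"]
    by (simp add: lin inv_commute)
  also have "\<dots> = coset ?W Q"
    using invar(2)[OF r_beta linear_beta, of "\<lambda>a b c d. free_gen (act u (\<alpha>\<^sub>A a), mu (\<beta>\<^sub>A b) c, \<beta>\<^sub>A d)"]
    by (simp add: lin Q_def beta_mu)
  finally have Q: "coset ?W Q' = coset ?W Q" .
  \<comment> \<open>Here it is easier to start from \<open>R\<close>: \<beta> is stripped off the
    second copy, then off the first.\<close>
  have "coset ?W R = coset ?W (\<Sum>i\<in>I. \<Sum>j\<in>I. free_gen
      (act u (\<beta>\<^sub>A (\<omega>\<^sub>A (x i))), \<alpha>\<^sub>A (x j), mu (y j) (\<psi>\<^sub>A (\<beta>\<^sub>A (y i)))))"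
    using invar(2)[OF r_beta linear_beta, of "\<lambda>a b c d. free_gen
        (act u (\<beta>\<^sub>A (\<omega>\<^sub>A a)), \<alpha>\<^sub>A c, mu d (\<psi>\<^sub>A (\<beta>\<^sub>A b)))"]
    by (simp add: lin R_def beta_mu psi_beta alpha_beta)
  also have "\<dots> = coset ?W R'"
    using invar(1)[OF r_beta linear_beta, of "\<lambda>a b. \<Sum>j\<in>I. free_gen
        (act u (\<omega>\<^sub>A a), \<alpha>\<^sub>A (x j), mu (y j) (\<psi>\<^sub>A b))"]
    by (simp add: lin R'_def omega_beta)
  finally have R: "coset ?W R' = coset ?W R" ..

  have "sweedler ?W (\<lambda>m0 m1. sweedler ?W (\<lambda>a1 a2. tens ?W (\<omega>\<^sub>M m0, a1, a2)) (\<Delta> m1)) (\<phi> m) =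
      coset ?W (Q' - R' - free_scale lam S)"
    by (simp add: coaction_eq comult_eq tens_def sweedler_coset_eq lin free_extend_simps
        omega_act u_def Q'_def R'_def S_def sum_subtractf free.scale_sum_right beta_one
        psi_beta omega_beta inv_commute)
  also have "\<dots> = coset ?W (Q - R - free_scale lam S)"
    by (intro coset_diff_cong W Q R refl)
  also have "\<dots> = coset ?W P"
  proof -
    \<comment> \<open>The negated difference of the two sides of \<open>aq\<close> is exactly the
      difference of the two representatives to be compared.\<close>
    have "- (P - Q + R - free_scale (- lam) S) \<in> ?W"
      using aq by (intro free.subspace_neg[OF W]) (simp only: coset_eq_iff[OF W])
    moreover have "- (P - Q + R - free_scale (- lam) S) = Q - R - free_scale lam S - P"
      by simp
    ultimately show ?thesis
      by (simp only: coset_eq_iff[OF W])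
  qed
  finally show ?thesis
    unfolding rhs .
qed

section \<open>Compatibility of coaction and action\<close>

text \<open>The first term of the comultiplication accounts for the whole left side. Its second term
  cancels against the summand built from the coaction of \<open>m\<close>, and its
  \<open>lam\<close> term against the last summand.\<close>

lemma coaction_act:
  "\<phi> (act m a) =
     qadd (tensor_rel sM sA)
       (qadd (tensor_rel sM sA)
         (sweedler (tensor_rel sM sA) (\<lambda>a1 a2. tens (tensor_rel sM sA) (act (\<omega>\<^sub>M m) a1, \<beta>\<^sub>A a2)) (\<Delta> a))
         (sweedler (tensor_rel sM sA) (\<lambda>m0 m1. tens (tensor_rel sM sA) (\<alpha>\<^sub>M m0, mu m1 (\<psi>\<^sub>A a))) (\<phi> m)))
       (qscale (tensor_rel sM sA) lam (tens (tensor_rel sM sA) (\<alpha>\<^sub>M (\<omega>\<^sub>M m), \<beta>\<^sub>A (\<psi>\<^sub>A a))))"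
proof -
  let ?W = "tensor_rel sM sA"
  note lin = bilinear_mod_def linear_mod_intros
  \<comment> \<open>For \<open>lam = 0\<close> both sides vanish; otherwise \<open>one\<close> acts
    as \<alpha>.\<close>
  have lam_one: "free_scale lam (free_gen (act (\<omega>\<^sub>M m) one, \<beta>\<^sub>A (\<psi>\<^sub>A a))) =
      free_scale lam (free_gen (\<alpha>\<^sub>M (\<omega>\<^sub>M m), \<beta>\<^sub>A (\<psi>\<^sub>A a)))"
    by (cases "lam = 0") (simp_all add: act_one)
  have "\<phi> (act m a) = coset ?W (\<Sum>i\<in>I. free_gen
      (act (\<omega>\<^sub>M m) (mu (\<omega>\<^sub>A (inv \<alpha>\<^sub>A a)) (inv \<beta>\<^sub>A (x i))), \<beta>\<^sub>A (y i)))"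
    by (simp add: coaction_eq act_act omega_act inv_commute)
  \<comment> \<open>Invariance under \<beta> trades the inverse at \<open>x i\<close> for a second
    \<beta> at \<open>y i\<close>, which matches the \<beta> applied to the second leg of the
    comultiplication.\<close>
  also have "\<dots> = coset ?W (\<Sum>i\<in>I. free_gen
      (act (\<omega>\<^sub>M m) (mu (\<omega>\<^sub>A (inv \<alpha>\<^sub>A a)) (x i)), \<beta>\<^sub>A (\<beta>\<^sub>A (y i))))"
    using r_invariant[OF subspace_tensor_rel r_beta linear_beta, of sM sA "\<lambda>b c. free_gen
        (act (\<omega>\<^sub>M m) (mu (\<omega>\<^sub>A (inv \<alpha>\<^sub>A a)) (inv \<beta>\<^sub>A b)), \<beta>\<^sub>A c)"]
    by (simp add: lin)
  finally show ?thesis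
    by (simp add: comult_eq coaction_eq tens_def sweedler_coset_eq lin free_extend_simps
        qadd_coset qscale_coset lam_one alpha_act alpha_omega_M beta_mu inv_commute)
qed

end

section \<open>Passage from an arbitrary \<open>r\<close> to a decomposition\<close>

theorem theorem2p48:
  fixes lam :: "'k::field"
    and sA :: "'k \<Rightarrow> 'a::ab_group_add \<Rightarrow> 'a"
    and mu :: "'a \<Rightarrow> 'a \<Rightarrow> 'a"
    and one :: 'a
    and \<alpha>\<^sub>A \<beta>\<^sub>A \<psi>\<^sub>A \<omega>\<^sub>A :: "'a \<Rightarrow> 'a"
    and r :: "('a \<times> 'a \<Rightarrow>\<^sub>0 'k) set"
    and sM :: "'k \<Rightarrow> 'm::ab_group_add \<Rightarrow> 'm"
    and act :: "'m \<Rightarrow> 'a \<Rightarrow> 'm"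
    and \<alpha>\<^sub>M \<beta>\<^sub>M \<psi>\<^sub>M \<omega>\<^sub>M :: "'m \<Rightarrow> 'm"
  assumes "anti_qt_bialgebra sA mu \<alpha>\<^sub>A \<beta>\<^sub>A one lam \<psi>\<^sub>A \<omega>\<^sub>A r"
    and "right_bihom_module sA mu \<alpha>\<^sub>A \<beta>\<^sub>A sM act \<alpha>\<^sub>M \<beta>\<^sub>M"
    and "bij \<alpha>\<^sub>M"
    and "Vector_Spaces.linear sM sM \<psi>\<^sub>M"
    and "Vector_Spaces.linear sM sM \<omega>\<^sub>M"
    and "\<And>m. \<alpha>\<^sub>M (\<omega>\<^sub>M m) = \<omega>\<^sub>M (\<alpha>\<^sub>M m)"
    and "\<And>m a. \<omega>\<^sub>M (act m a) = act (\<omega>\<^sub>M m) (\<omega>\<^sub>A a)"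
    \<comment> \<open>conditions left implicit in the informal statement, without which it fails:\<close>
    and "\<And>m. \<alpha>\<^sub>M (\<psi>\<^sub>M m) = \<psi>\<^sub>M (\<alpha>\<^sub>M m)"
    and "\<And>m. \<beta>\<^sub>M (\<psi>\<^sub>M m) = \<psi>\<^sub>M (\<beta>\<^sub>M m)"
    and "\<And>m. \<beta>\<^sub>M (\<omega>\<^sub>M m) = \<omega>\<^sub>M (\<beta>\<^sub>M m)"
    and "\<And>m. \<psi>\<^sub>M (\<omega>\<^sub>M m) = \<omega>\<^sub>M (\<psi>\<^sub>M m)"
    and "\<And>m a. \<psi>\<^sub>M (act m a) = act (\<psi>\<^sub>M m) (\<psi>\<^sub>A a)"
    and "\<And>m. lam \<noteq> 0 \<Longrightarrow> act m one = \<alpha>\<^sub>M m"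
  shows "right_infBH_Hopf_module lam sA mu
           (comult_r sA mu \<alpha>\<^sub>A \<beta>\<^sub>A one lam \<psi>\<^sub>A \<omega>\<^sub>A r) \<alpha>\<^sub>A \<beta>\<^sub>A \<psi>\<^sub>A \<omega>\<^sub>A
           sM act (coaction_r sA \<beta>\<^sub>A r sM act \<alpha>\<^sub>M \<omega>\<^sub>M) \<alpha>\<^sub>M \<beta>\<^sub>M \<psi>\<^sub>M \<omega>\<^sub>M"
proof -
  have r: "r \<in> quotient_space (tensor_rel sA sA)"
    using assms(1) by (rule anti_qt_bialgebra.r_in)
  \<comment> \<open>Choosing a decomposition of \<open>r\<close> supplies the parameters
    \<open>I\<close>, \<open>x\<close>, \<open>y\<close> of the locale; the resulting Hopf module
    does not mention them.\<close>
  obtain I :: "('a \<times> 'a) set" and x y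
    where r_sum: "r = coset (tensor_rel sA sA) (\<Sum>i\<in>I. free_gen (x i, y i))"
    by (rule quotient_space_tensor_sum[OF r])
  interpret anti_qt_module sA mu \<alpha>\<^sub>A \<beta>\<^sub>A one lam \<psi>\<^sub>A \<omega>\<^sub>A r sM act \<alpha>\<^sub>M \<beta>\<^sub>M \<psi>\<^sub>M \<omega>\<^sub>M I x y
    by (intro anti_qt_module.intro anti_qt_module_axioms.intro assms r_sum)
  show ?thesis
    unfolding right_infBH_Hopf_module_def right_bihom_comodule_def
      right_infBH_Hopf_module_axioms_def Let_def
    by (intro conjI allI assms linear_psi linear_omega linear_comult linear_coaction
        psi_coaction omega_coaction coaction_coassoc coaction_act)
qed

end
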